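(* For a graph $G$, $\operatorname{th}_{\lfloor \operatorname{Z}\rfloor}(G)=3$ if and only if $G$ is (isomorphic to) a member of $$\mathcal{G} = \{C_4,\ P_4,\ 2K_2,\ K_1 \dot{\cup} P_3,\ K_2 \dot{\cup} 2K_1,\ 4K_1,\ K_3,\ P_3,\ K_1 \dot{\cup} K_2,\ 3K_1\}.$$
   Context: All graphs are finite, simple, undirected. $K_n$, $P_n$, $C_n$ are the complete graph, path and cycle on $n$ vertices; $\dot\cup$ denotes disjoint union of graphs and $mH$ is the disjoint union of $m$ copies of $H$. $\lfloor \operatorname{Z}\rfloor$ forcing: each vertex of $G$ is blue or white. A vertex is active if it is blue and has not yet performed a force. The $\lfloor \operatorname{Z}\rfloor$ color change rule: (i) a blue vertex $u$ can force a white vertex $w$ to become blue if $w$ is the only white neighbor of $u$; or (ii) if $v$ is active and all neighbors of $v$ are blue, then $v$ can force any single white vertex $w$ of $G$ to become blue (a "hop"). Write $u\to w$ when $u$ forces $w$. For $B\subseteq V(G)$, color $B$ blue and $V(G)\setminus B$ white, and apply the rule repeatedly, one force at a time, until no longer possible; the unordered set $\mathcal F$ of forces performed is called a set of $\lfloor \operatorname{Z}\rfloor$ forces of $B$ (it depends on choices). Put $\mathcal F^{(0)}=B$, and for $t\ge 0$ let $\mathcal F^{(t+1)}$ be the set of (white) vertices $w$ such that some force $v\to w$ is in $\mathcal F$ and $v$ can force $w$ by the rule when exactly the vertices in $\bigcup_{i=0}^t\mathcal F^{(i)}$ are blue. The propagation time $\operatorname{pt}_{\lfloor \operatorname{Z}\rfloor}(G;\mathcal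 F)$ is the least $t'$ with $V(G)=\bigcup_{i=0}^{t'}\mathcal F^{(i)}$, and is $\infty$ if the forces in $\mathcal F$ do not color all of $V(G)$ blue. Define $\operatorname{pt}_{\lfloor \operatorname{Z}\rfloor}(G;B)$ as the minimum of $\operatorname{pt}_{\lfloor \operatorname{Z}\rfloor}(G;\mathcal F)$ over all sets $\mathcal F$ of $\lfloor \operatorname{Z}\rfloor$ forces of $B$, $\operatorname{th}_{\lfloor \operatorname{Z}\rfloor}(G;B)=|B|+\operatorname{pt}_{\lfloor \operatorname{Z}\rfloor}(G;B)$, and $\operatorname{th}_{\lfloor \operatorname{Z}\rfloor}(G)=\min_{B\subseteq V(G)}\operatorname{th}_{\lfloor \operatorname{Z}\rfloor}(G;B)$. *)

theory Defs
  imports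
    "Graph_Theory.Pair_Digraph"
    "Graph_Theory.Digraph_Isomorphism"
    "HOL-Library.Extended_Nat"
begin

text \<open>
  A finite simple undirected graph is a \<open>pair_graph\<close>: a finite vertex set with a symmetric
  irreflexive set of arcs, where an edge \<open>{u, v}\<close> is given by the arcs \<open>(u, v)\<close> and \<open>(v, u)\<close>.
\<close>

definition graph_iso :: "'a pair_pre_digraph \<Rightarrow> 'b pair_pre_digraph \<Rightarrow> bool" where
  "graph_iso G H \<longleftrightarrow> digraph_iso (with_proj G) (with_proj H)"

definition complete_graph :: "nat \<Rightarrow> nat pair_pre_digraph" where
  "complete_graph n = \<lparr> pverts = {..<n}, parcs = {(i, j). i < n \<and> j < n \<and> i \<noteq> j} \<rparr>"

definition path_graph :: "nat \<Rightarrow> nat pair_pre_digraph" where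
  "path_graph n = \<lparr> pverts = {..<n}, parcs = {(i, j). i < n \<and> j < n \<and> (j = Suc i \<or> i = Suc j)} \<rparr>"

text \<open>This is the cycle on \<open>n\<close> vertices for \<open>n \<ge> 3\<close>.\<close>

definition cycle_graph :: "nat \<Rightarrow> nat pair_pre_digraph" where
  "cycle_graph n = \<lparr> pverts = {..<n},
     parcs = {(i, j). i < n \<and> j < n \<and> (j = Suc i mod n \<or> i = Suc j mod n)} \<rparr>"

definition disjoint_union ::
    "'a pair_pre_digraph \<Rightarrow> 'b pair_pre_digraph \<Rightarrow> ('a + 'b) pair_pre_digraph" where
  "disjoint_union G H = \<lparr> pverts = pverts G <+> pverts H,
     parcs = {(Inl u, Inl v) | u v. (u, v) \<in> parcs G} \<union> {(Inr u, Inr v) | u v. (u, v) \<in> parcs H} \<rparr>"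

definition copies :: "nat \<Rightarrow> 'a pair_pre_digraph \<Rightarrow> (nat \<times> 'a) pair_pre_digraph" where
  "copies m H = \<lparr> pverts = {..<m} \<times> pverts H,
     parcs = {((i, u), (i, v)) | i u v. i < m \<and> (u, v) \<in> parcs H} \<rparr>"

lemma pair_graph_complete_graph: "pair_graph (complete_graph n)"
proof -
  have "finite {(i, j). i < n \<and> j < n \<and> i \<noteq> j}"
    by (rule finite_subset[of _ "{..<n} \<times> {..<n}"]) auto
  then show ?thesis
    by unfold_locales (auto simp: complete_graph_def symmetric_def intro!: symI)
qed

lemma pair_graph_path_graph: "pair_graph (path_graph n)"
proof -
  have "finite {(i, j). i < n \<and> j < n \<and> (j = Suc i \<or> i = Suc j)}"
    by (rule finite_subset[of _ "{..<n} \<times> {..<n}"]) auto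
  then show ?thesis
    by unfold_locales (auto simp: path_graph_def symmetric_def intro!: symI)
qed

lemma pair_graph_cycle_graph:
  assumes "n \<ge> 3"
  shows "pair_graph (cycle_graph n)"
proof -
  have "finite {(i, j). i < n \<and> j < n \<and> (j = Suc i mod n \<or> i = Suc j mod n)}"
    by (rule finite_subset[of _ "{..<n} \<times> {..<n}"]) auto
  moreover have "Suc i mod n \<noteq> i" "i \<noteq> Suc i mod n" if "i < n" for i
    using that assms by (cases "Suc i = n"; simp)+
  ultimately show ?thesis
    by unfold_locales (auto simp: cycle_graph_def symmetric_def intro!: symI)
qed

lemma pair_graph_disjoint_union:
  assumes "pair_graph G" "pair_graph H"
  shows "pair_graph (disjoint_union G H)"
proof -
  interpret G: pair_graph G by fact
  interpret H: pair_graph H by fact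
  have eq: "parcs (disjoint_union G H) =
      map_prod Inl Inl ` parcs G \<union> map_prod Inr Inr ` parcs H"
    by (force simp: disjoint_union_def)
  show ?thesis
  proof unfold_locales
    show "finite (parcs (disjoint_union G H))"
      unfolding eq using G.pair_finite_arcs H.pair_finite_arcs by auto
    show "finite (pverts (disjoint_union G H))"
      using G.pair_finite_verts H.pair_finite_verts by (auto simp: disjoint_union_def)
    show "symmetric (with_proj (disjoint_union G H))"
      using G.pair_sym_arcs H.pair_sym_arcs
      by (auto simp: symmetric_def disjoint_union_def sym_def)
  qed (auto simp: disjoint_union_def dest: G.wellformed' H.wellformed' G.no_loops' H.no_loops')
qed

lemma pair_graph_copies:
  assumes "pair_graph H"
  shows "pair_graph (copies m H)"
proof -
  interpret H: pair_graph H by fact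
  have eq: "parcs (copies m H) = (\<lambda>(i, u, v). ((i, u), (i, v))) ` ({..<m} \<times> parcs H)"
    by (force simp: copies_def)
  show ?thesis
  proof unfold_locales
    show "finite (parcs (copies m H))"
      unfolding eq using H.pair_finite_arcs by auto
    show "finite (pverts (copies m H))"
      using H.pair_finite_verts by (auto simp: copies_def)
    show "symmetric (with_proj (copies m H))"
      using H.pair_sym_arcs by (auto simp: symmetric_def copies_def sym_def)
  qed (auto simp: copies_def dest: H.wellformed' H.no_loops')
qed

text \<open>
  Below, \<open>S\<close> is the current set of blue vertices and \<open>P\<close> the set of forces performed so far,
  a force \<open>u \<rightarrow> w\<close> being the pair \<open>(u, w)\<close>.
\<close>

definition active :: "'a set \<Rightarrow> ('a \<times> 'a) set \<Rightarrow> 'a \<Rightarrow> bool" where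
  "active S P v \<longleftrightarrow> v \<in> S \<and> (\<forall>w. (v, w) \<notin> P)"

definition can_force ::
    "'a pair_pre_digraph \<Rightarrow> 'a set \<Rightarrow> ('a \<times> 'a) set \<Rightarrow> 'a \<Rightarrow> 'a \<Rightarrow> bool" where
  "can_force G S P v w \<longleftrightarrow>
     v \<in> S \<and> w \<in> pverts G - S \<and>
     ({x \<in> pverts G - S. (v, x) \<in> parcs G} = {w} \<or>
      active S P v \<and> {x \<in> pverts G. (v, x) \<in> parcs G} \<subseteq> S)"

inductive forcing_run ::
    "'a pair_pre_digraph \<Rightarrow> 'a set \<Rightarrow> 'a set \<Rightarrow> ('a \<times> 'a) set \<Rightarrow> bool"
  for G :: "'a pair_pre_digraph" and B :: "'a set" where
  start: "forcing_run G B B {}"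
| force: "forcing_run G B S P \<Longrightarrow> can_force G S P v w
    \<Longrightarrow> forcing_run G B (insert w S) (insert (v, w) P)"

definition set_of_forces :: "'a pair_pre_digraph \<Rightarrow> 'a set \<Rightarrow> ('a \<times> 'a) set \<Rightarrow> bool" where
  "set_of_forces G B F \<longleftrightarrow> (\<exists>S. forcing_run G B S F \<and> (\<nexists>v w. can_force G S F v w))"

text \<open>
  \<open>layer G B F t\<close> is the set \<open>F\<^sup>(\<^sup>t\<^sup>)\<close>. Each vertex outside \<open>B\<close> is the target of at most one
  force of \<open>F\<close>, and no vertex of \<open>B\<close> is a target; hence when exactly the vertices of \<open>S\<close> are
  blue, the forces of \<open>F\<close> that have been performed are those with target in \<open>S\<close>.
\<close>

fun layer :: "'a pair_pre_digraph \<Rightarrow> 'a set \<Rightarrow> ('a \<times> 'a) set \<Rightarrow> nat \<Rightarrow> 'a set" where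
  "layer G B F 0 = B"
| "layer G B F (Suc t) =
     (let S = (\<Union>i\<in>{..t}. layer G B F i)
      in {w. \<exists>v. (v, w) \<in> F \<and> can_force G S {(x, y) \<in> F. y \<in> S} v w})"

text \<open>
  Values are extended naturals; the infimum of a nonempty set is its minimum, and the infimum of
  the empty set is \<open>\<infinity>\<close>.
\<close>

definition pt_forces :: "'a pair_pre_digraph \<Rightarrow> 'a set \<Rightarrow> ('a \<times> 'a) set \<Rightarrow> enat" where
  "pt_forces G B F = Inf {enat t | t. pverts G = (\<Union>i\<in>{..t}. layer G B F i)}"

definition pt_set :: "'a pair_pre_digraph \<Rightarrow> 'a set \<Rightarrow> enat" where
  "pt_set G B = (INF F\<in>{F. set_of_forces G B F}. pt_forces G B F)"

definition th_set :: "'a pair_pre_digraph \<Rightarrow> 'a set \<Rightarrow> enat" where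
  "th_set G B = enat (card B) + pt_set G B"

definition th :: "'a pair_pre_digraph \<Rightarrow> enat" where
  "th G = (INF B\<in>Pow (pverts G). th_set G B)"

end

theory Submission
  imports Defs
begin

text \<open>
  Each vertex performs at most one force, so \<open>|B|\<close> blue vertices color at most \<open>|B|\<close> new vertices per
  step and \<open>|V(G)| \<le> |B| (1 + t)\<close> if \<open>B\<close> propagates in \<open>t\<close> steps. Hence \<open>|B| + t \<le> 3\<close> forces
  \<open>|V(G)| \<le> 3\<close> unless \<open>|B| = 2\<close> and \<open>t = 1\<close>. In that case, for \<open>|V(G)| = 4\<close>, the forces are \<open>a \<rightarrow> c\<close> and
  \<open>b \<rightarrow> d\<close> performed simultaneously, which is possible iff \<open>ad\<close> and \<open>bc\<close> are not edges, i.e. iff \<open>G\<close>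
  is a spanning subgraph of the 4-cycle \<open>a c d b\<close>. Taking \<open>B = V(G)\<close> shows that \<open>th G \<le> 3\<close> if
  \<open>|V(G)| \<le> 3\<close>, and \<open>th G \<le> 2\<close> iff \<open>|V(G)| \<le> 2\<close>.
\<close>

section \<open>Isomorphism with an explicitly listed graph\<close>

text \<open>A library isomorphism has separate maps for arcs, heads and tails. Arcs of a pair graph
  are pairs of vertices, so only the vertex map is a real choice.\<close>

lemma graph_iso_iff_bij:
  assumes "pair_graph G" "pair_graph H"
  shows "graph_iso G H \<longleftrightarrow> (\<exists>f. bij_betw f (pverts G) (pverts H) \<and>
    (\<forall>u\<in>pverts G. \<forall>v\<in>pverts G. (u, v) \<in> parcs G \<longleftrightarrow> (f u, f v) \<in> parcs H))"
proof
  interpret G: pair_graph G by fact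
  assume "graph_iso G H"
  then obtain h where h: "G.digraph_isomorphism h" and eq: "with_proj H = app_iso h (with_proj G)"
    unfolding graph_iso_def digraph_iso_def by blast
  let ?f = "iso_verts h"
  have pv: "pverts H = ?f ` pverts G" and pa: "parcs H = iso_arcs h ` parcs G"
    and "iso_tail h = fst" "iso_head h = snd"
    using arg_cong[OF eq, of verts] arg_cong[OF eq, of arcs] arg_cong[OF eq, of tail]
      arg_cong[OF eq, of head] by auto
  \<comment> \<open>Compatibility with tails and heads, which are \<open>fst\<close> and
    \<open>snd\<close> on both sides, fixes both components of the image of an arc.\<close>
  then have "iso_arcs h e = map_prod ?f ?f e" if "e \<in> parcs G" for e
    using h that by (cases e) (auto simp: G.digraph_isomorphism_def prod_eq_iff)
  then have pa': "parcs H = map_prod ?f ?f ` parcs G"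
    unfolding pa by auto
  have inj: "inj_on ?f (pverts G)"
    using G.digraph_isomorphism_inj_on_verts[OF h] by simp
  have "(u, v) \<in> parcs G \<longleftrightarrow> (?f u, ?f v) \<in> parcs H" if "u \<in> pverts G" "v \<in> pverts G" for u v
  proof
    assume "(?f u, ?f v) \<in> parcs H"
    then obtain x y where "(x, y) \<in> parcs G" "?f u = ?f x" "?f v = ?f y"
      unfolding pa' by auto
    then show "(u, v) \<in> parcs G"
      using that inj_onD[OF inj] G.wellformed' by metis
  qed (auto simp: pa')
  then show "\<exists>f. bij_betw f (pverts G) (pverts H) \<and>
    (\<forall>u\<in>pverts G. \<forall>v\<in>pverts G. (u, v) \<in> parcs G \<longleftrightarrow> (f u, f v) \<in> parcs H)"
    using inj pv by (auto simp: bij_betw_def)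
next
  interpret G: pair_graph G by fact
  interpret H: pair_graph H by fact
  assume "\<exists>f. bij_betw f (pverts G) (pverts H) \<and>
    (\<forall>u\<in>pverts G. \<forall>v\<in>pverts G. (u, v) \<in> parcs G \<longleftrightarrow> (f u, f v) \<in> parcs H)"
  then obtain f where f: "bij_betw f (pverts G) (pverts H)"
    and arcs: "\<And>u v. u \<in> pverts G \<Longrightarrow> v \<in> pverts G \<Longrightarrow> (u, v) \<in> parcs G \<longleftrightarrow> (f u, f v) \<in> parcs H"
    by blast
  let ?h = "\<lparr>iso_verts = f, iso_arcs = map_prod f f, iso_head = snd, iso_tail = fst\<rparr>"
  have inj: "inj_on f (pverts G)" and im: "f ` pverts G = pverts H"
    using f by (auto simp: bij_betw_def)
  have "inj_on (map_prod f f) (parcs G)"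
    by (intro inj_on_subset[OF map_prod_inj_on[OF inj inj]])
      (auto dest: G.wellformed')
  then have iso: "G.digraph_isomorphism ?h"
    using inj G.wf_digraph_axioms by (auto simp: G.digraph_isomorphism_def)
  have "parcs H \<subseteq> map_prod f f ` parcs G"
  proof
    fix e assume e: "e \<in> parcs H"
    obtain x y where xy: "e = (x, y)" by force
    with e have "x \<in> f ` pverts G" "y \<in> f ` pverts G"
      unfolding im by (auto dest: H.wellformed')
    with e xy arcs show "e \<in> map_prod f f ` parcs G" by force
  qed
  moreover have "map_prod f f ` parcs G \<subseteq> parcs H"
    using arcs by (auto dest: G.wellformed')
  ultimately have "with_proj H = app_iso ?h (with_proj G)"
    using im by (intro pre_digraph.equality) auto
  with iso show "graph_iso G H"
    unfolding graph_iso_def digraph_iso_def by blast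
qed

text \<open>Once the vertices of \<open>H\<close> are listed as \<open>ys\<close>, a bijection
  amounts to a list \<open>xs\<close> of the vertices of \<open>G\<close>. Arcs are symmetric and
  loops absent, so pairs with \<open>i < j\<close> suffice. For a concrete \<open>H\<close> this
  leaves finitely many arc conditions.\<close>

lemma graph_iso_iff_list:
  assumes "pair_graph G" "pair_graph H" and ys: "distinct ys" "pverts H = set ys"
  shows "graph_iso G H \<longleftrightarrow> (\<exists>xs. length xs = length ys \<and> distinct xs \<and> pverts G = set xs \<and>
    (\<forall>j<length ys. \<forall>i<j. (xs ! i, xs ! j) \<in> parcs G \<longleftrightarrow> (ys ! i, ys ! j) \<in> parcs H))"
    (is "_ \<longleftrightarrow> ?R")
proof
  interpret G: pair_graph G by fact
  assume "graph_iso G H"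
  then obtain f where f: "bij_betw f (pverts G) (pverts H)"
    and arcs: "\<And>u v. u \<in> pverts G \<Longrightarrow> v \<in> pverts G \<Longrightarrow> (u, v) \<in> parcs G \<longleftrightarrow> (f u, f v) \<in> parcs H"
    using assms by (auto simp: graph_iso_iff_bij)
  define g where "g = inv_into (pverts G) f"
  have g: "bij_betw g (set ys) (pverts G)"
    using bij_betw_inv_into[OF f] ys by (simp add: g_def)
  have fg: "f (g y) = y" if "y \<in> set ys" for y
    using f that ys by (auto simp: g_def bij_betw_def f_inv_into_f)
  have gG: "g y \<in> pverts G" if "y \<in> set ys" for y
    using bij_betwE[OF g] that by blast
  have "distinct (map g ys)" "pverts G = set (map g ys)"
    using g ys by (auto simp: distinct_map bij_betw_def)
  then show ?R
    using arcs fg gG by (intro exI[of _ "map g ys"]) (auto simp: nth_map)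
next
  interpret G: pair_graph G by fact
  interpret H: pair_graph H by fact
  assume ?R
  then obtain xs where len: "length xs = length ys" and xs: "distinct xs" "pverts G = set xs"
    and less: "\<And>i j. i < j \<Longrightarrow> j < length ys \<Longrightarrow>
      (xs ! i, xs ! j) \<in> parcs G \<longleftrightarrow> (ys ! i, ys ! j) \<in> parcs H" by blast
  have arcs: "(xs ! i, xs ! j) \<in> parcs G \<longleftrightarrow> (ys ! i, ys ! j) \<in> parcs H"
    if "i < length ys" "j < length ys" for i j
    using less[of i j] less[of j i] that G.arcs_symmetric H.arcs_symmetric G.no_loops' H.no_loops'
    by (metis linorder_neqE_nat)
  define n where "n = length ys"
  \<comment> \<open>\<open>f\<close> sends \<open>xs ! i\<close> to \<open>ys ! i\<close>.\<close>
  define f where "f = (!) ys \<circ> inv_into {..<n} ((!) xs)"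
  have bx: "bij_betw ((!) xs) {..<n} (pverts G)" and "bij_betw ((!) ys) {..<n} (pverts H)"
    using xs ys len by (auto simp: n_def intro!: bij_betw_nth)
  then have "bij_betw f (pverts G) (pverts H)"
    unfolding f_def by (blast intro: bij_betw_trans bij_betw_inv_into)
  moreover have "f (xs ! i) = ys ! i" if "i < n" for i
    using bx that by (simp add: f_def bij_betw_def)
  then have "(u, v) \<in> parcs G \<longleftrightarrow> (f u, f v) \<in> parcs H" if "u \<in> pverts G" "v \<in> pverts G" for u v
    using that arcs len unfolding xs in_set_conv_nth n_def by metis
  ultimately show "graph_iso G H"
    using assms by (auto simp: graph_iso_iff_bij)
qed

section \<open>Forcing\<close>

text \<open>In an ordinary force \<open>w\<close> is the only white neighbor of \<open>v\<close>; in
  a hop \<open>v\<close> has no white neighbor.\<close>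

lemma can_force_arcD:
  "can_force G S P v w \<Longrightarrow> (v, x) \<in> parcs G \<Longrightarrow> x \<in> pverts G - S \<Longrightarrow> x = w"
  unfolding can_force_def by blast

lemma forcing_run_subset: "forcing_run G B S F \<Longrightarrow> B \<subseteq> S"
  by (induction rule: forcing_run.induct) auto

text \<open>A force of either kind leaves its source without white neighbors, and this persists
  because the blue set only grows.\<close>

lemma forcing_run_source:
  "forcing_run G B S F \<Longrightarrow> (v, w) \<in> F \<Longrightarrow>
    w \<in> S \<and> w \<notin> B \<and> {x \<in> pverts G. (v, x) \<in> parcs G} \<subseteq> S"
proof (induction arbitrary: v w rule: forcing_run.induct)
  case (force S P v' w')
  then show ?case
    using forcing_run_subset[OF force.hyps(1)] by (auto simp: can_force_def active_def)
qed simp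

text \<open>After its first force a vertex has no white neighbor left for an ordinary force and is
  not active for a hop, so it never forces again.\<close>

lemma forcing_run_single_valued: "forcing_run G B S F \<Longrightarrow> single_valued F"
proof (induction rule: forcing_run.induct)
  case (force S P v w)
  have "(v, x) \<notin> P" for x
    using force.hyps(2) forcing_run_source[OF force.hyps(1), of v x]
    by (auto simp: can_force_def active_def)
  with force.IH show ?case by (auto simp: single_valued_def)
qed simp

text \<open>A target stays blue, and only white vertices can be forced.\<close>

lemma forcing_run_single_valued_converse: "forcing_run G B S F \<Longrightarrow> single_valued (F\<inverse>)"
proof (induction rule: forcing_run.induct)
  case (force S P v w)
  have "(x, w) \<notin> P" for x
    using force.hyps(2) forcing_run_source[OF force.hyps(1), of x w]
    by (auto simp: can_force_def)
  with force.IH show ?case by (auto simp: single_valued_def)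
qed simp

section \<open>Layers and their sizes\<close>

text \<open>No force targets \<open>B\<close>, so at the start no force counts as performed and all
  of \<open>B\<close> is active.\<close>

lemma layer_1:
  assumes "set_of_forces G B F"
  shows "layer G B F (Suc 0) = {w. \<exists>v. (v, w) \<in> F \<and> can_force G B {} v w}"
proof -
  have "{(x, y) \<in> F. y \<in> B} = {}"
    using assms forcing_run_source unfolding set_of_forces_def by fastforce
  moreover have "(\<Union>i\<le>0. layer G B F i) = B" by simp
  ultimately show ?thesis by (simp only: layer.simps(2) Let_def)
qed

lemma layer_SucD:
  assumes "w \<in> layer G B F (Suc t)"
  shows "\<exists>v. (v, w) \<in> F \<and> v \<in> (\<Union>i\<le>t. layer G B F i) \<and> w \<notin> (\<Union>i\<le>t. layer G B F i)"
  using assms by (auto simp: Let_def can_force_def)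

declare layer.simps(2) [simp del]

text \<open>In each step there are at most \<open>card B\<close> active vertices.\<close>

lemma card_layers_le:
  assumes "finite B" and F: "set_of_forces G B F"
  shows "finite (\<Union>i\<le>t. layer G B F i) \<and> card (\<Union>i\<le>t. layer G B F i) \<le> card B * Suc t"
proof (induction t)
  case 0
  then show ?case using assms by simp
next
  case (Suc t)
  let ?S = "\<Union>i\<le>t. layer G B F i"
  let ?L = "layer G B F (Suc t)"
  have sv: "single_valued F" "single_valued (F\<inverse>)"
    using F forcing_run_single_valued forcing_run_single_valued_converse
    unfolding set_of_forces_def by blast+
  have S: "(\<Union>i\<le>Suc t. layer G B F i) = ?S \<union> ?L"
    by (auto simp: atMost_Suc)
  \<comment> \<open>The unique source of the force with target \<open>w\<close>; arbitrary if
    \<open>w\<close> is not a target.\<close>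
  define src where "src w = (SOME v. (v, w) \<in> F)" for w
  have src: "src w = v" if "(v, w) \<in> F" for v w
    unfolding src_def using that sv(2) by (intro some_equality) (auto simp: single_valued_def)
  have inS: "src w \<in> ?S \<and> (src w, w) \<in> F" if w: "w \<in> ?S - B" for w
  proof -
    obtain i where i: "i \<le> t" "w \<in> layer G B F i" using w by blast
    with w obtain j where j: "i = Suc j" by (cases i) auto
    with i layer_SucD[of w G B F j] obtain v where "(v, w) \<in> F" "v \<in> (\<Union>i\<le>j. layer G B F i)"
      by blast
    moreover have "(\<Union>i\<le>j. layer G B F i) \<subseteq> ?S" using i j by (intro UN_mono) auto
    ultimately show ?thesis using src by blast
  qed
  have inj: "inj_on src (?S - B)"
    using inS sv(1) by (intro inj_onI) (metis single_valuedD)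
  have L: "(src w, w) \<in> F \<and> src w \<in> ?S \<and> w \<notin> ?S" if "w \<in> ?L" for w
    using layer_SucD[OF that] src by metis
  have injL: "inj_on src ?L"
    using L sv(1) by (intro inj_onI) (metis single_valuedD)
  \<comment> \<open>The sources of the new layer are blue vertices that have not forced yet: a
    source shared with a blue \<open>y\<close> outside \<open>B\<close> would give
    \<open>y = w\<close>, but \<open>w\<close> is white.\<close>
  have sub: "src ` ?L \<subseteq> ?S - src ` (?S - B)"
  proof (intro image_subsetI DiffI notI)
    fix w assume w: "w \<in> ?L"
    then show "src w \<in> ?S" using L by blast
    assume "src w \<in> src ` (?S - B)"
    then obtain y where y: "y \<in> ?S - B" "src w = src y" by blast
    then have "y = w" using L[OF w] inS[OF y(1)] sv(1) by (metis single_valuedD)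
    then show False using y L[OF w] by blast
  qed
  have fin: "finite ?S" using Suc by blast
  have B: "B \<subseteq> ?S" by (auto intro!: bexI[of _ 0])
  have finL: "finite ?L"
    using finite_imageD[OF finite_subset[OF sub] injL] fin by blast
  \<comment> \<open>Every blue vertex outside \<open>B\<close> has used up one blue source, so
    exactly \<open>card B\<close> blue vertices remain available.\<close>
  have "card ?L = card (src ` ?L)" using card_image[OF injL] by simp
  also have "\<dots> \<le> card (?S - src ` (?S - B))" using sub fin by (intro card_mono) auto
  also have "\<dots> = card ?S - card (?S - B)"
    using inS fin inj by (subst card_Diff_subset) (auto simp: card_image simp del: UN_iff)
  also have "\<dots> = card B"
    using B fin assms(1) by (simp add: card_Diff_subset card_mono)
  finally have "card ?L \<le> card B" .
  with Suc.IH fin finL card_Un_le[of ?S ?L] show ?case unfolding S by simp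
qed

section \<open>Throttling numbers at most three\<close>

text \<open>The nested infima range over extended naturals, so a finite bound is witnessed by a
  single choice of \<open>B\<close>, \<open>F\<close> and \<open>t\<close>.\<close>

lemma th_le_iff:
  "th G \<le> enat k \<longleftrightarrow> (\<exists>B F t. B \<subseteq> pverts G \<and> set_of_forces G B F \<and>
     pverts G = (\<Union>i\<le>t. layer G B F i) \<and> card B + t \<le> k)" (is "_ \<longleftrightarrow> ?R")
proof
  assume "th G \<le> enat k"
  \<comment> \<open>An infimum strictly below a bound has a member below it; hence the shift to
    \<open>Suc k\<close>, repeated below with \<open>Suc p\<close>.\<close>
  then have "th G < enat (Suc k)" by (metis enat_ord_simps(2) le_less_trans lessI)
  then obtain B where B: "B \<subseteq> pverts G" and "th_set G B < enat (Suc k)"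
    unfolding th_def INF_less_iff by blast
  then obtain p where p: "pt_set G B = enat p" "card B + p \<le> k"
    by (cases "pt_set G B") (auto simp: th_set_def)
  then have "pt_set G B < enat (Suc p)" by simp
  then obtain F where F: "set_of_forces G B F" "pt_forces G B F < enat (Suc p)"
    unfolding pt_set_def INF_less_iff by blast
  then obtain t where "pverts G = (\<Union>i\<le>t. layer G B F i)" "t \<le> p"
    unfolding pt_forces_def Inf_less_iff by auto
  with B F p show ?R by (intro exI[of _ B] exI[of _ F] exI[of _ t]) auto
next
  assume ?R
  then obtain B F t where B: "B \<subseteq> pverts G" and F: "set_of_forces G B F"
    and t: "pverts G = (\<Union>i\<le>t. layer G B F i)" and le: "card B + t \<le> k" by blast
  have "th G \<le> th_set G B" unfolding th_def using B by (auto intro: INF_lower)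
  also have "pt_set G B \<le> pt_forces G B F" unfolding pt_set_def using F by (auto intro: INF_lower)
  then have "th_set G B \<le> enat (card B) + pt_forces G B F"
    unfolding th_set_def by (rule add_left_mono)
  also have "pt_forces G B F \<le> enat t" unfolding pt_forces_def using t by (auto intro!: Inf_lower)
  then have "enat (card B) + pt_forces G B F \<le> enat (card B) + enat t"
    by (rule add_left_mono)
  also have "\<dots> \<le> enat k" using le by simp
  finally show "th G \<le> enat k" .
qed

text \<open>With all vertices blue, no force is possible and the propagation time is 0.\<close>

lemma th_le_card: "th G \<le> enat (card (pverts G))"
proof -
  have "set_of_forces G (pverts G) {}"
    unfolding set_of_forces_def
    by (intro exI[of _ "pverts G"] conjI forcing_run.start) (auto simp: can_force_def)
  then show ?thesis
    unfolding th_le_iff by (intro exI[of _ "pverts G"] exI[of _ "{}"] exI[of _ 0]) auto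
qed

text \<open>The excluded pairs are the diagonals of the 4-cycle \<open>w x y z\<close>. One
  direction of each is enough for a symmetric arc set.\<close>

definition spans_in_C4 :: "'a pair_pre_digraph \<Rightarrow> bool" where
  "spans_in_C4 G \<longleftrightarrow> (\<exists>w x y z. distinct [w, x, y, z] \<and> pverts G = {w, x, y, z} \<and>
     (w, y) \<notin> parcs G \<and> (x, z) \<notin> parcs G)"

context
  fixes G :: "'a pair_pre_digraph"
  assumes G: "pair_graph G"
begin

interpretation pair_graph G by (rule G)

lemma th_le_2_iff: "th G \<le> enat 2 \<longleftrightarrow> card (pverts G) \<le> 2"
proof
  assume "th G \<le> enat 2"
  then obtain B F t where B: "B \<subseteq> pverts G" and F: "set_of_forces G B F"
    and t: "pverts G = (\<Union>i\<le>t. layer G B F i)" and le: "card B + t \<le> 2"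
    unfolding th_le_iff by blast
  have "card (pverts G) \<le> card B * Suc t"
    using card_layers_le[OF finite_subset[OF B pair_finite_verts] F, of t] t by simp
  \<comment> \<open>In each case the product \<open>card B * Suc t\<close> is at most 2.\<close>
  moreover have "card B = 0 \<or> card B = 1 \<and> t \<le> 1 \<or> card B = 2 \<and> t = 0"
    using le by auto
  ultimately show "card (pverts G) \<le> 2" by auto
next
  assume "card (pverts G) \<le> 2"
  then show "th G \<le> enat 2" using th_le_card[of G] by (auto elim: order_trans)
qed

text \<open>Two blue vertices must color at least two more in one step, so each of them forces
  exactly once, and neither may see the target of the other.\<close>

lemma spans_in_C4I:
  assumes B: "B \<subseteq> pverts G" "card B = 2" and F: "set_of_forces G B F"
    and t: "pverts G = B \<union> layer G B F (Suc 0)" and card: "card (pverts G) > 3"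
  shows "spans_in_C4 G"
proof -
  have sv: "single_valued F"
    using F forcing_run_single_valued unfolding set_of_forces_def by blast
  note L = layer_1[OF F]
  have finB: "finite B" using B(2) by (simp add: card_ge_0_finite)
  have "card (layer G B F (Suc 0) - B) \<ge> 2"
  proof -
    have "card (pverts G - B) \<ge> 2" using card B finB by (simp add: card_Diff_subset)
    moreover have "pverts G - B = layer G B F (Suc 0) - B" using t by blast
    ultimately show ?thesis by simp
  qed
  then obtain T where "T \<subseteq> layer G B F (Suc 0)" "card T = 2"
    by (meson Diff_subset obtain_subset_with_card_n subset_trans)
  then obtain c d where cd: "c \<noteq> d" "c \<in> layer G B F (Suc 0)" "d \<in> layer G B F (Suc 0)"
    by (auto simp: card_2_iff)
  then obtain a b where a: "(a, c) \<in> F" "can_force G B {} a c"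
    and b: "(b, d) \<in> F" "can_force G B {} b d"
    unfolding L by blast
  have "a \<noteq> b" using sv a(1) b(1) cd(1) by (auto simp: single_valued_def)
  have ab: "a \<in> B" "b \<in> B" "c \<in> pverts G - B" "d \<in> pverts G - B"
    using a b by (auto simp: can_force_def)
  then have Beq: "B = {a, b}"
    using \<open>a \<noteq> b\<close> B(2) by (metis card_2_iff' card_2_iff insert_iff insert_commute)
  \<comment> \<open>A third new vertex would need a source in \<open>B\<close>, but \<open>a\<close>
    and \<open>b\<close> already have their only targets.\<close>
  have "w \<in> {c, d}" if "w \<in> pverts G - B" for w
  proof -
    from that t have "w \<in> layer G B F (Suc 0)" by blast
    then obtain v where "(v, w) \<in> F" "v \<in> B" unfolding L by (auto simp: can_force_def)
    then show ?thesis using sv a(1) b(1) Beq by (auto simp: single_valued_def)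
  qed
  then have V: "pverts G = {a, c, d, b}" using Beq B(1) ab by auto
  \<comment> \<open>Both forces are legal when exactly \<open>B\<close> is blue: \<open>d\<close> is
    white when \<open>a\<close> forces \<open>c\<close>, and \<open>c\<close> is white when
    \<open>b\<close> forces \<open>d\<close>.\<close>
  have "(a, d) \<notin> parcs G" "(b, c) \<notin> parcs G"
    using can_force_arcD[OF a(2), of d] can_force_arcD[OF b(2), of c] ab cd(1) by auto
  then have "(a, d) \<notin> parcs G" "(c, b) \<notin> parcs G"
    using arcs_symmetric[of c b] by blast+
  moreover have "distinct [a, c, d, b]"
    using ab cd(1) \<open>a \<noteq> b\<close> by auto
  ultimately show ?thesis
    using V unfolding spans_in_C4_def by blast
qed

text \<open>Start from \<open>a\<close> and \<open>b\<close>, consecutive on the 4-cycle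
  \<open>a c d b\<close>. The only possible white neighbor of \<open>a\<close> is \<open>c\<close>,
  that of \<open>b\<close> is \<open>d\<close>; each force is ordinary if the edge is present and a
  hop otherwise.\<close>

lemma th_le_3_if_spans_in_C4:
  assumes "spans_in_C4 G"
  shows "th G \<le> enat 3"
proof -
  obtain a c d b where dist: "distinct [a, c, d, b]" and V: "pverts G = {a, c, d, b}"
    and ad: "(a, d) \<notin> parcs G" and "(c, b) \<notin> parcs G"
    using assms unfolding spans_in_C4_def by blast
  then have bc: "(b, c) \<notin> parcs G" using arcs_symmetric by blast
  let ?B = "{a, b}" and ?F = "{(b, d), (a, c)}"
  have f1: "can_force G ?B {} a c" "can_force G ?B {} b d"
    using dist V ad bc no_loops' by (auto simp: can_force_def active_def)
  \<comment> \<open>A run performs one force at a time, so the second force is also checked with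
    \<open>c\<close> already blue; \<open>f1\<close> serves for the simultaneous layer.\<close>
  have f2: "can_force G {c, a, b} {(a, c)} b d"
    using dist V ad bc no_loops' by (auto simp: can_force_def active_def)
  have "forcing_run G ?B {d, c, a, b} ?F"
    using forcing_run.force[OF forcing_run.force[OF forcing_run.start f1(1)] f2] .
  then have F: "set_of_forces G ?B ?F"
    unfolding set_of_forces_def using V
    by (intro exI[of _ "{d, c, a, b}"]) (auto simp: can_force_def)
  have "layer G ?B ?F (Suc 0) = {c, d}"
    unfolding layer_1[OF F] using f1 by auto
  then have "pverts G = (\<Union>i\<le>Suc 0. layer G ?B ?F i)"
    using V by (auto simp: atMost_Suc)
  with F V dist show ?thesis
    unfolding th_le_iff by (intro exI[of _ ?B] exI[of _ ?F] exI[of _ "Suc 0"]) auto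
qed

text \<open>The value 3 is isolated by the bounds 3 and 2; the latter is excluded by having more
  than two vertices.\<close>

lemma th_eq_3_iff: "th G = 3 \<longleftrightarrow> card (pverts G) = 3 \<or> spans_in_C4 G"
proof -
  have "th G \<le> enat 3 \<longleftrightarrow> card (pverts G) \<le> 3 \<or> spans_in_C4 G"
  proof
    assume "th G \<le> enat 3"
    then obtain B F t where B: "B \<subseteq> pverts G" and F: "set_of_forces G B F"
      and t: "pverts G = (\<Union>i\<le>t. layer G B F i)" and le: "card B + t \<le> 3"
      unfolding th_le_iff by blast
    have bound: "card (pverts G) \<le> card B * Suc t"
      using card_layers_le[OF finite_subset[OF B pair_finite_verts] F, of t] t by simp
    show "card (pverts G) \<le> 3 \<or> spans_in_C4 G"
    \<comment> \<open>Among the pairs with sum at most 3, only this one has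
      \<open>card B * Suc t\<close> above 3.\<close>
    proof (cases "card B = 2 \<and> t = 1")
      case True
      then have "pverts G = B \<union> layer G B F (Suc 0)" using t by (auto simp: atMost_Suc)
      then show ?thesis using spans_in_C4I[OF B _ F] True by linarith
    next
      case False
      then have "card B = 0 \<or> card B = 1 \<and> t \<le> 2 \<or> card B = 2 \<and> t = 0 \<or> card B = 3 \<and> t = 0"
        using le by auto
      then show ?thesis using bound by auto
    qed
  next
    assume "card (pverts G) \<le> 3 \<or> spans_in_C4 G"
    then show "th G \<le> enat 3"
      using th_le_3_if_spans_in_C4 th_le_card[of G] by (auto elim: order_trans)
  qed
  moreover have "card (pverts G) = 4" if "spans_in_C4 G"
    using that unfolding spans_in_C4_def by auto
  moreover have "th G = 3 \<longleftrightarrow> th G \<le> enat 3 \<and> \<not> th G \<le> enat 2"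
    by (cases "th G") (auto simp: numeral_eq_enat)
  ultimately show ?thesis using th_le_2_iff by auto
qed

end

section \<open>The graphs on three vertices and the spanning subgraphs of the 4-cycle\<close>

text \<open>
  The bits record which edges of the triangle or 4-cycle \<open>a b c (d)\<close> are present. Up to rotation
  there are four bit strings of length 3 and six of length 4, which give the ten graphs.
\<close>

definition cyclic3 :: "'a pair_pre_digraph \<Rightarrow> bool \<Rightarrow> bool \<Rightarrow> bool \<Rightarrow> bool" where
  "cyclic3 G p q r \<longleftrightarrow> (\<exists>a b c. distinct [a, b, c] \<and> pverts G = {a, b, c} \<and>
     ((a, b) \<in> parcs G \<longleftrightarrow> p) \<and> ((b, c) \<in> parcs G \<longleftrightarrow> q) \<and> ((c, a) \<in> parcs G \<longleftrightarrow> r))"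

definition cyclic4 :: "'a pair_pre_digraph \<Rightarrow> bool \<Rightarrow> bool \<Rightarrow> bool \<Rightarrow> bool \<Rightarrow> bool" where
  "cyclic4 G p q r s \<longleftrightarrow> (\<exists>a b c d. distinct [a, b, c, d] \<and> pverts G = {a, b, c, d} \<and>
     (a, c) \<notin> parcs G \<and> (b, d) \<notin> parcs G \<and>
     ((a, b) \<in> parcs G \<longleftrightarrow> p) \<and> ((b, c) \<in> parcs G \<longleftrightarrow> q) \<and>
     ((c, d) \<in> parcs G \<longleftrightarrow> r) \<and> ((d, a) \<in> parcs G \<longleftrightarrow> s))"

text \<open>Unrolls a quantifier over lists of fixed length into quantifiers over the
  entries.\<close>

lemma ex_list_length_Suc:
  "(\<exists>xs. length xs = Suc n \<and> P xs) \<longleftrightarrow> (\<exists>x xs. length xs = n \<and> P (x # xs))"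
  by (metis length_Suc_conv)

lemma card_3_iff_cyclic3: "card (pverts G) = 3 \<longleftrightarrow> (\<exists>p q r. cyclic3 G p q r)"
  unfolding card_3_iff cyclic3_def distinct_length_2_or_more by auto blast

lemma spans_in_C4_iff_cyclic4: "spans_in_C4 G \<longleftrightarrow> (\<exists>p q r s. cyclic4 G p q r s)"
  unfolding spans_in_C4_def cyclic4_def by blast

lemma cyclic3_rotate: "cyclic3 G p q r \<Longrightarrow> cyclic3 G q r p"
  unfolding cyclic3_def
proof (elim exE)
  fix a b c
  assume "distinct [a, b, c] \<and> pverts G = {a, b, c} \<and>
     ((a, b) \<in> parcs G \<longleftrightarrow> p) \<and> ((b, c) \<in> parcs G \<longleftrightarrow> q) \<and> ((c, a) \<in> parcs G \<longleftrightarrow> r)"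
  then show "\<exists>a b c. distinct [a, b, c] \<and> pverts G = {a, b, c} \<and>
     ((a, b) \<in> parcs G \<longleftrightarrow> q) \<and> ((b, c) \<in> parcs G \<longleftrightarrow> r) \<and> ((c, a) \<in> parcs G \<longleftrightarrow> p)"
    by - (rule exI[of _ b], rule exI[of _ c], rule exI[of _ a], auto)
qed

text \<open>Relabels \<open>a b c d\<close> as \<open>b c d a\<close>. This reverses the diagonal
  from \<open>a\<close> to \<open>c\<close>, which is where symmetry of the arcs enters.\<close>

lemma cyclic4_rotate:
  assumes "pair_graph G" and "cyclic4 G p q r s"
  shows "cyclic4 G q r s p"
proof -
  interpret pair_graph G by fact
  obtain a b c d where "distinct [a, b, c, d]" "pverts G = {a, b, c, d}"
    "(a, c) \<notin> parcs G" "(b, d) \<notin> parcs G" "(a, b) \<in> parcs G \<longleftrightarrow> p" "(b, c) \<in> parcs G \<longleftrightarrow> q"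
    "(c, d) \<in> parcs G \<longleftrightarrow> r" "(d, a) \<in> parcs G \<longleftrightarrow> s"
    using assms(2) unfolding cyclic4_def by blast
  then show ?thesis
    unfolding cyclic4_def using arcs_symmetric[of c a]
    by - (rule exI[of _ b], rule exI[of _ c], rule exI[of _ d], rule exI[of _ a], auto)
qed

text \<open>The list criterion compares the pair \<open>(x, z)\<close>, whereas
  \<open>cyclic3\<close> closes the cycle with \<open>(c, a)\<close>; symmetry of \<open>G\<close>
  reconciles them.\<close>

lemma graph_iso_iff_cyclic3:
  assumes G: "pair_graph G" and H: "pair_graph H"
    and "distinct [x, y, z]" "pverts H = {x, y, z}"
  shows "graph_iso G H \<longleftrightarrow> cyclic3 G ((x, y) \<in> parcs H) ((y, z) \<in> parcs H) ((x, z) \<in> parcs H)"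
proof -
  interpret pair_graph G by fact
  have "graph_iso G H \<longleftrightarrow> (\<exists>a b c. distinct [a, b, c] \<and> pverts G = {a, b, c} \<and>
     ((b, c) \<in> parcs G \<longleftrightarrow> (y, z) \<in> parcs H) \<and> ((a, c) \<in> parcs G \<longleftrightarrow> (x, z) \<in> parcs H) \<and>
     ((a, b) \<in> parcs G \<longleftrightarrow> (x, y) \<in> parcs H))"
    using assms(3,4) graph_iso_iff_list[OF G H, of "[x, y, z]"]
    by (simp add: ex_list_length_Suc All_less_Suc)
  also have "\<dots> \<longleftrightarrow> cyclic3 G ((x, y) \<in> parcs H) ((y, z) \<in> parcs H) ((x, z) \<in> parcs H)"
    using arcs_symmetric unfolding cyclic3_def by (intro arg_cong[of _ _ Ex] ext) blast
  finally show ?thesis .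
qed

lemma graph_iso_iff_cyclic4:
  assumes G: "pair_graph G" and H: "pair_graph H"
    and "distinct [w, x, y, z]" "pverts H = {w, x, y, z}" "(w, y) \<notin> parcs H" "(x, z) \<notin> parcs H"
  shows "graph_iso G H \<longleftrightarrow>
    cyclic4 G ((w, x) \<in> parcs H) ((x, y) \<in> parcs H) ((y, z) \<in> parcs H) ((w, z) \<in> parcs H)"
proof -
  interpret pair_graph G by fact
  have "graph_iso G H \<longleftrightarrow> (\<exists>a b c d. distinct [a, b, c, d] \<and> pverts G = {a, b, c, d} \<and>
     ((c, d) \<in> parcs G \<longleftrightarrow> (y, z) \<in> parcs H) \<and> (b, d) \<notin> parcs G \<and>
     ((a, d) \<in> parcs G \<longleftrightarrow> (w, z) \<in> parcs H) \<and> ((b, c) \<in> parcs G \<longleftrightarrow> (x, y) \<in> parcs H) \<and>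
     (a, c) \<notin> parcs G \<and> ((a, b) \<in> parcs G \<longleftrightarrow> (w, x) \<in> parcs H))"
    using assms(3-) graph_iso_iff_list[OF G H, of "[w, x, y, z]"]
    by (simp add: ex_list_length_Suc All_less_Suc)
  also have "\<dots> \<longleftrightarrow>
    cyclic4 G ((w, x) \<in> parcs H) ((x, y) \<in> parcs H) ((y, z) \<in> parcs H) ((w, z) \<in> parcs H)"
    using arcs_symmetric unfolding cyclic4_def by (intro arg_cong[of _ _ Ex] ext) blast
  finally show ?thesis .
qed

section \<open>The ten graphs as bit strings\<close>

context
  fixes G :: "'a pair_pre_digraph"
  assumes G: "pair_graph G"
begin

lemma graph_iso_complete_3: "graph_iso G (complete_graph 3) \<longleftrightarrow> cyclic3 G True True True"
  using graph_iso_iff_cyclic3[OF G pair_graph_complete_graph, of 0 1 2 3]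
  by (simp add: complete_graph_def lessThan_nat_numeral lessThan_Suc insert_commute)

lemma graph_iso_path_3: "graph_iso G (path_graph 3) \<longleftrightarrow> cyclic3 G True True False"
  using graph_iso_iff_cyclic3[OF G pair_graph_path_graph, of 0 1 2 3]
  by (simp add: path_graph_def lessThan_nat_numeral lessThan_Suc insert_commute)

text \<open>The edge is listed first, so it gives the first bit.\<close>

lemma graph_iso_K1_K2:
  "graph_iso G (disjoint_union (complete_graph 1) (complete_graph 2)) \<longleftrightarrow> cyclic3 G True False False"
  using graph_iso_iff_cyclic3[OF G pair_graph_disjoint_union[OF pair_graph_complete_graph
    pair_graph_complete_graph], of "Inr 0" "Inr 1" "Inl 0" 1 2]
  by (simp add: disjoint_union_def complete_graph_def lessThan_nat_numeral lessThan_Suc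
    insert_commute Plus_def)

lemma graph_iso_3K1: "graph_iso G (copies 3 (complete_graph 1)) \<longleftrightarrow> cyclic3 G False False False"
  using graph_iso_iff_cyclic3[OF G pair_graph_copies[OF pair_graph_complete_graph],
    of "(0, 0)" "(1, 0)" "(2, 0)" 3 1]
  by (simp add: copies_def complete_graph_def lessThan_nat_numeral lessThan_Suc insert_commute)

lemma graph_iso_cycle_4: "graph_iso G (cycle_graph 4) \<longleftrightarrow> cyclic4 G True True True True"
  using graph_iso_iff_cyclic4[OF G pair_graph_cycle_graph, of 4 0 1 2 3]
  by (simp add: cycle_graph_def lessThan_nat_numeral lessThan_Suc insert_commute)

lemma graph_iso_path_4: "graph_iso G (path_graph 4) \<longleftrightarrow> cyclic4 G True True True False"
  using graph_iso_iff_cyclic4[OF G pair_graph_path_graph, of 0 1 2 3 4]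
  by (simp add: path_graph_def lessThan_nat_numeral lessThan_Suc insert_commute)

text \<open>The two edges become opposite sides of the 4-cycle.\<close>

lemma graph_iso_2K2: "graph_iso G (copies 2 (complete_graph 2)) \<longleftrightarrow> cyclic4 G True False True False"
  using graph_iso_iff_cyclic4[OF G pair_graph_copies[OF pair_graph_complete_graph],
    of "(0, 0)" "(0, 1)" "(1, 0)" "(1, 1)" 2 2]
  by (simp add: copies_def complete_graph_def lessThan_nat_numeral lessThan_Suc insert_commute
    insert_Times_insert)

text \<open>The path is listed before the isolated vertex, so its edges become adjacent
  sides.\<close>

lemma graph_iso_K1_P3:
  "graph_iso G (disjoint_union (complete_graph 1) (path_graph 3)) \<longleftrightarrow> cyclic4 G True True False False"
  using graph_iso_iff_cyclic4[OF G pair_graph_disjoint_union[OF pair_graph_complete_graph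
    pair_graph_path_graph], of "Inr 0" "Inr 1" "Inr 2" "Inl 0" 1 3]
  by (simp add: disjoint_union_def complete_graph_def path_graph_def lessThan_nat_numeral lessThan_Suc
    insert_commute Plus_def)

lemma graph_iso_K2_2K1:
  "graph_iso G (disjoint_union (complete_graph 2) (copies 2 (complete_graph 1))) \<longleftrightarrow>
    cyclic4 G True False False False"
  using graph_iso_iff_cyclic4[OF G pair_graph_disjoint_union[OF pair_graph_complete_graph
    pair_graph_copies[OF pair_graph_complete_graph]],
    of "Inl 0" "Inl 1" "Inr (0, 0)" "Inr (1, 0)" 2 2 1]
  by (simp add: disjoint_union_def complete_graph_def copies_def lessThan_nat_numeral lessThan_Suc
    insert_commute Plus_def)

lemma graph_iso_4K1: "graph_iso G (copies 4 (complete_graph 1)) \<longleftrightarrow> cyclic4 G False False False False"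
  using graph_iso_iff_cyclic4[OF G pair_graph_copies[OF pair_graph_complete_graph],
    of "(0, 0)" "(1, 0)" "(2, 0)" "(3, 0)" 4 1]
  by (simp add: copies_def complete_graph_def lessThan_nat_numeral lessThan_Suc insert_commute)

text \<open>The number of true bits determines a string of length 3 up to rotation.\<close>

lemma ex_cyclic3_iff:
  "(\<exists>p q r. cyclic3 G p q r) \<longleftrightarrow> cyclic3 G True True True \<or> cyclic3 G True True False \<or>
     cyclic3 G True False False \<or> cyclic3 G False False False"
proof (rule iffI; (elim exE)?)
  fix p q r assume "cyclic3 G p q r"
  moreover from this have "cyclic3 G q r p" "cyclic3 G r p q"
    using cyclic3_rotate by blast+
  ultimately show "cyclic3 G True True True \<or> cyclic3 G True True False \<or>
     cyclic3 G True False False \<or> cyclic3 G False False False"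
    by (cases p; cases q; cases r) auto
qed blast

text \<open>Here two true bits form two classes, adjacent and opposite; any other number of true
  bits forms one.\<close>

lemma ex_cyclic4_iff:
  "(\<exists>p q r s. cyclic4 G p q r s) \<longleftrightarrow> cyclic4 G True True True True \<or>
     cyclic4 G True True True False \<or> cyclic4 G True False True False \<or>
     cyclic4 G True True False False \<or> cyclic4 G True False False False \<or>
     cyclic4 G False False False False"
proof (rule iffI; (elim exE)?)
  fix p q r s assume "cyclic4 G p q r s"
  moreover from this have "cyclic4 G q r s p" "cyclic4 G r s p q" "cyclic4 G s p q r"
    using cyclic4_rotate[OF G] by blast+
  ultimately show "cyclic4 G True True True True \<or>
     cyclic4 G True True True False \<or> cyclic4 G True False True False \<or>
     cyclic4 G True True False False \<or> cyclic4 G True False False False \<or>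
     cyclic4 G False False False False"
    by (cases p; cases q; cases r; cases s) auto
qed blast

end

theorem proposition5p3:
  fixes G :: "'a pair_pre_digraph"
  assumes "pair_graph G"
  shows "th G = 3 \<longleftrightarrow>
    graph_iso G (cycle_graph 4) \<or>
    graph_iso G (path_graph 4) \<or>
    graph_iso G (copies 2 (complete_graph 2)) \<or>
    graph_iso G (disjoint_union (complete_graph 1) (path_graph 3)) \<or>
    graph_iso G (disjoint_union (complete_graph 2) (copies 2 (complete_graph 1))) \<or>
    graph_iso G (copies 4 (complete_graph 1)) \<or>
    graph_iso G (complete_graph 3) \<or>
    graph_iso G (path_graph 3) \<or>
    graph_iso G (disjoint_union (complete_graph 1) (complete_graph 2)) \<or>
    graph_iso G (copies 3 (complete_graph 1))"
  \<comment> \<open>Both sides become disjunctions of the same ten bit patterns, in different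
    orders.\<close>
  unfolding th_eq_3_iff[OF assms] card_3_iff_cyclic3 spans_in_C4_iff_cyclic4
    ex_cyclic3_iff[OF assms] ex_cyclic4_iff[OF assms]
    graph_iso_complete_3[OF assms] graph_iso_path_3[OF assms] graph_iso_K1_K2[OF assms]
    graph_iso_3K1[OF assms] graph_iso_cycle_4[OF assms] graph_iso_path_4[OF assms]
    graph_iso_2K2[OF assms] graph_iso_K1_P3[OF assms] graph_iso_K2_2K1[OF assms]
    graph_iso_4K1[OF assms]
  by blast

end
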